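(* Consider a system $\dot x=f(x)$ with invariant $H$, and the extended system $(\dot x,\dot y)=F(x,y)$ on $D\subset\mathbb{R}^{n+d}$ described in the context. Apply a symplectic Runge–Kutta (SRK) method with step size $h$ to the extended system (as long as the stage and step values exist and lie in $D$). Then this is a structure-preserving discretization in the following sense: 1. the method exactly preserves all quadratic invariants of the extended system; 2. if the initial data satisfy $G(x_0,y_0)=0$, the numerical solution remains on the constraint manifold $\mathcal M$, i.e. $G(x_n,y_n)=0$, for all time steps $n$; 3. eliminating the auxiliary variables via the constraint, i.e. taking the one-step method $x_n\mapsto x_{n+1}$ given by the $x$-component of one SRK step of the extended system started from $(x_n,\varphi(x_n))$, produces a method for $\dot x=f(x)$ that preserves the original invariant of the original system: $H(x_{n+1})=H(x_n)$; 4. if the SRK method is of order $p$, so is this reduced integrator for $\dot x=f(x)$.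
   Context: An $s$-stage Runge–Kutta method with coefficients $(a_{ij},b_i)$ is called a symplectic Runge–Kutta (SRK) method if $b_ia_{ij}+b_ja_{ji}-b_ib_j=0$ for $1\le i,j\le s$. Let $U\subset\mathbb{R}^n$ and $D\subset\mathbb{R}^{n+d}$ be open (the considered domains), $f:U\to\mathbb{R}^n$ and $H:U\to\mathbb{R}$ smooth, where $H$ is an invariant of $\dot x=f(x)$, i.e. $\nabla H(x)^\top f(x)=0$ on $U$. The constraint map $G=(G_1,\ldots,G_d)^\top$ has homogeneous quadratic components $G_i(x,y)=\tfrac12 z^\top Q^iz$, $z=(x^\top,y^\top)^\top$, $Q^i=\begin{pmatrix}Q^i_{11}&Q^i_{12}\\(Q^i_{12})^\top&Q^i_{22}\end{pmatrix}$ symmetric. Its Jacobian is $DG=(A\mid B)$, with $A(x,y)\in\mathbb{R}^{d\times n}$ having $i$-th row $x^\top Q^i_{11}+y^\top(Q^i_{12})^\top$ and $B(x,y)\in\mathbb{R}^{d\times d}$ having $i$-th row $x^\top Q^i_{12}+y^\top Q^i_{22}$. The matrix $B$ has full rank on $D$, and $B^\dagger=(B^\top B)^{-1}B^\top$. The constraint manifold $\mathcal M=\{(x,y)\in D:G(x,y)=0\}$ is the graph $\{(x,\varphi(x)):x\in U\}$ of a smooth $\varphi:U\to\mathbb{R}^d$. The quadratic function $\widetilde H:\mathbb{R}^{n+d}\to\mathbb{R}$ satisfies $\widetilde H(x,y)=H(x)$ on $\mathcal M$. The smooth map $\tilde f:D\to\mathbb{R}^n$ satisfies $\tilde f(x,\varphi(x))=f(x)$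 for $x\in U$. The extended system is $$\begin{pmatrix}\dot x\\ \dot y\end{pmatrix}=F(x,y):=\begin{pmatrix}\tilde f(x,y)\\ -B^\dagger(x,y)A(x,y)\tilde f(x,y)\end{pmatrix}.$$ A quadratic invariant of the extended system is a polynomial $I(x,y)$ of degree at most two with $\nabla I(x,y)^\top F(x,y)=0$ for all $(x,y)\in D$.
   Formalization: In item 3, H(x_{n+1}) = H(x_n) is proved under the added assumption that the quadratic function H̃ is an invariant of the extended system on all of D; H̃ = H on M alone does not suffice, because stages may leave M. *)

theory Defs
  imports "HOL-Analysis.Analysis"
begin

section \<open>Smooth maps, invariants, quadratic functions\<close>

primrec C_k_on :: "nat \<Rightarrow> 'a::real_normed_vector set \<Rightarrow> ('a \<Rightarrow> 'b::real_normed_vector) \<Rightarrow> bool" where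
  "C_k_on 0 S f \<longleftrightarrow> continuous_on S f"
| "C_k_on (Suc k) S f \<longleftrightarrow> (\<forall>x\<in>S. f differentiable (at x)) \<and>
     (\<forall>v. C_k_on k S (\<lambda>x. frechet_derivative f (at x) v))"

text \<open>Only used for open \<open>S\<close> in finite-dimensional spaces, where continuity of all iterated
  directional derivatives is the usual notion of smoothness.\<close>

definition smooth_on :: "'a::real_normed_vector set \<Rightarrow> ('a \<Rightarrow> 'b::real_normed_vector) \<Rightarrow> bool" where
  "smooth_on S f \<longleftrightarrow> (\<forall>k. C_k_on k S f)"

definition invariant_on :: "'a::real_inner set \<Rightarrow> ('a \<Rightarrow> 'a) \<Rightarrow> ('a \<Rightarrow> real) \<Rightarrow> bool" where
  "invariant_on S g V \<longleftrightarrow> (\<forall>x\<in>S. \<exists>D. GDERIV V x :> D \<and> D \<bullet> g x = 0)"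

text \<open>Polynomials of degree at most two.\<close>

definition quadratic :: "('a::real_inner \<Rightarrow> real) \<Rightarrow> bool" where
  "quadratic q \<longleftrightarrow> (\<exists>L c k. linear L \<and> (\<forall>z. q z = z \<bullet> L z + c \<bullet> z + k))"

section \<open>Runge-Kutta methods\<close>

definition symplectic_rk :: "('s::finite \<Rightarrow> 's \<Rightarrow> real) \<Rightarrow> ('s \<Rightarrow> real) \<Rightarrow> bool" where
  "symplectic_rk a b \<longleftrightarrow> (\<forall>i j. b i * a i j + b j * a j i - b i * b j = 0)"

text \<open>A step is a relation because the stage equations of an implicit method need not be
  solvable, nor uniquely solvable. All stage and step values are required to lie in \<open>V\<close>.\<close>

definition rk_step ::
  "('s::finite \<Rightarrow> 's \<Rightarrow> real) \<Rightarrow> ('s \<Rightarrow> real) \<Rightarrow> ('a::real_vector \<Rightarrow> 'a) \<Rightarrow> 'a set \<Rightarrow> real \<Rightarrow> 'a \<Rightarrow> 'a \<Rightarrow> bool"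
where
  "rk_step a b g V h z0 z1 \<longleftrightarrow> z0 \<in> V \<and> z1 \<in> V \<and>
     (\<exists>Z. (\<forall>i. Z i \<in> V \<and> Z i = z0 + h *\<^sub>R (\<Sum>j\<in>UNIV. a i j *\<^sub>R g (Z j))) \<and>
          z1 = z0 + h *\<^sub>R (\<Sum>i\<in>UNIV. b i *\<^sub>R g (Z i)))"

definition solves_ode_on ::
  "real set \<Rightarrow> ('a::real_normed_vector \<Rightarrow> 'a) \<Rightarrow> 'a set \<Rightarrow> (real \<Rightarrow> 'a) \<Rightarrow> bool" where
  "solves_ode_on J g S X \<longleftrightarrow> (\<forall>t\<in>J. X t \<in> S \<and> (X has_vector_derivative g (X t)) (at t))"

text \<open>
  A one-step method for \<open>x' = g(x)\<close> on \<open>S\<close> has order (at least) \<open>p\<close> if its local error is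
  \<open>O(h\<^sup>p\<^sup>+\<^sup>1)\<close> as \<open>h \<rightarrow> 0\<close>. In \<open>\<Psi> r h x0 x1\<close> the radius \<open>r\<close> restricts the step to stages within
  distance \<open>r\<close> of the initial value: for an implicit method the stage equations may have
  further solutions far away, and the order refers to the branch near \<open>x0\<close>. Such a branch is
  required to exist and to give a unique result for all small \<open>h\<close>.
\<close>

definition has_order ::
  "nat \<Rightarrow> ('a::real_normed_vector \<Rightarrow> 'a) \<Rightarrow> 'a set \<Rightarrow> (real \<Rightarrow> real \<Rightarrow> 'a \<Rightarrow> 'a \<Rightarrow> bool) \<Rightarrow> bool" where
  "has_order p g S \<Psi> \<longleftrightarrow>
     (\<forall>x0\<in>S. \<exists>r>0.
        (\<forall>\<^sub>F h in at 0. \<exists>!x1. \<Psi> r h x0 x1) \<and>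
        (\<forall>T>0. \<forall>X. X 0 = x0 \<and> solves_ode_on {-T<..<T} g S X \<longrightarrow>
           (\<exists>C. \<forall>\<^sub>F h in at 0. \<forall>x1. \<Psi> r h x0 x1 \<longrightarrow> norm (x1 - X h) \<le> C * \<bar>h\<bar> ^ (p + 1))))"

text \<open>Order of the coefficients \<open>(a, b)\<close>: the order is attained for every smooth system
  on an open subset of the space \<open>'v\<close>.\<close>

definition rk_has_order ::
  "'v::euclidean_space itself \<Rightarrow> nat \<Rightarrow> ('s::finite \<Rightarrow> 's \<Rightarrow> real) \<Rightarrow> ('s \<Rightarrow> real) \<Rightarrow> bool" where
  "rk_has_order _ p a b \<longleftrightarrow>
     (\<forall>(g :: 'v \<Rightarrow> 'v) S. open S \<and> smooth_on S g \<longrightarrow>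
        has_order p g S (\<lambda>r h z0. rk_step a b g (S \<inter> ball z0 r) h z0))"

section \<open>The extended system\<close>

text \<open>\<open>G\<^sub>i(z) = z\<^sup>T Q\<^sup>i z / 2\<close> with the symmetric matrix \<open>Q\<^sup>i\<close> given by its blocks.\<close>

definition constraint_map ::
  "('d::finite \<Rightarrow> real^'n^'n) \<Rightarrow> ('d \<Rightarrow> real^'d^'n) \<Rightarrow> ('d \<Rightarrow> real^'d^'d) \<Rightarrow> (real^'n) \<times> (real^'d) \<Rightarrow> real^'d"
where
  "constraint_map Q11 Q12 Q22 = (\<lambda>(x, y). \<chi> i.
     (1/2) * (x \<bullet> (Q11 i *v x + Q12 i *v y) + y \<bullet> (transpose (Q12 i) *v x + Q22 i *v y)))"

definition constraint_manifold ::
  "('d::finite \<Rightarrow> real^'n^'n) \<Rightarrow> ('d \<Rightarrow> real^'d^'n) \<Rightarrow> ('d \<Rightarrow> real^'d^'d) \<Rightarrow>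
   ((real^'n) \<times> (real^'d)) set \<Rightarrow> ((real^'n) \<times> (real^'d)) set"
where
  "constraint_manifold Q11 Q12 Q22 D = {z \<in> D. constraint_map Q11 Q12 Q22 z = 0}"

text \<open>The two blocks of the Jacobian \<open>DG = (A | B)\<close>.\<close>

definition jac_A ::
  "('d::finite \<Rightarrow> real^'n^'n) \<Rightarrow> ('d \<Rightarrow> real^'d^'n) \<Rightarrow> (real^'n) \<times> (real^'d) \<Rightarrow> real^'n^'d"
where
  "jac_A Q11 Q12 = (\<lambda>(x, y). \<chi> i. x v* Q11 i + y v* transpose (Q12 i))"

definition jac_B ::
  "('d::finite \<Rightarrow> real^'d^'n) \<Rightarrow> ('d \<Rightarrow> real^'d^'d) \<Rightarrow> (real^'n) \<times> (real^'d) \<Rightarrow> real^'d^'d"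
where
  "jac_B Q12 Q22 = (\<lambda>(x, y). \<chi> i. x v* Q12 i + y v* Q22 i)"

definition pseudo_inv :: "real^'m^'k \<Rightarrow> real^'k^'m" where
  "pseudo_inv M = matrix_inv (transpose M ** M) ** transpose M"

definition extended_field ::
  "('d::finite \<Rightarrow> real^'n^'n) \<Rightarrow> ('d \<Rightarrow> real^'d^'n) \<Rightarrow> ('d \<Rightarrow> real^'d^'d) \<Rightarrow>
   ((real^'n) \<times> (real^'d) \<Rightarrow> real^'n) \<Rightarrow> (real^'n) \<times> (real^'d) \<Rightarrow> (real^'n) \<times> (real^'d)"
where
  "extended_field Q11 Q12 Q22 f' z =
     (f' z, - (pseudo_inv (jac_B Q12 Q22 z) *v (jac_A Q11 Q12 z *v f' z)))"

text \<open>One Runge-Kutta step of the extended system \<open>g\<close> from \<open>(x0, \<phi>(x0))\<close>, projected to \<open>x\<close>.\<close>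

definition reduced_step ::
  "('s::finite \<Rightarrow> 's \<Rightarrow> real) \<Rightarrow> ('s \<Rightarrow> real) \<Rightarrow> ('x::real_vector \<times> 'y::real_vector \<Rightarrow> 'x \<times> 'y) \<Rightarrow>
   ('x \<Rightarrow> 'y) \<Rightarrow> ('x \<times> 'y) set \<Rightarrow> real \<Rightarrow> 'x \<Rightarrow> 'x \<Rightarrow> bool"
where
  "reduced_step a b g \<phi> V h x0 x1 \<longleftrightarrow> (\<exists>y1. rk_step a b g V h (x0, \<phi> x0) (x1, y1))"

end

theory Submission
  imports Defs
begin

text \<open>
  The first three claims come from one fact: a symplectic Runge-Kutta method preserves every
  quadratic invariant (\<open>symplectic_rk_preserves_quadratic\<close>), because the symplecticity
  condition cancels exactly the terms of second order in \<open>h\<close> in the change of a quadratic function.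
  The components of \<open>G\<close> are such invariants: \<open>B\<close> is square of full rank, so
  \<open>B\<^sup>\<dagger>\<close> is its inverse and \<open>DG F = A f' - B B\<^sup>\<dagger> A f' = 0\<close>
  (\<open>extended_field_preserves_constraint\<close>). Hence numerical solutions that start on
  \<open>M\<close> stay there. As \<open>M\<close> is the graph of \<open>\<phi>\<close>, the endpoint of a step from
  \<open>(x0, \<phi> x0)\<close> is \<open>(x1, \<phi> x1)\<close>, and where the quadratic \<open>H'\<close> is an invariant of the
  extended system its preservation is that of \<open>H\<close>.

  For the order, a solution \<open>X\<close> of the original system lifts to the solution
  \<open>(X, \<phi> \<circ> X)\<close> of the extended system: differentiating
  \<open>G (x, \<phi> x) = 0\<close> determines the derivative of \<open>\<phi>\<close> along \<open>f\<close>, and it is the second component of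
  \<open>F\<close> (\<open>graph_lift_solves_extended\<close>). The reduced step is the \<open>x\<close>-component of a step of the
  extended system, so its local error is at most that of the latter. The order of the coefficients
  applies to the extended system since \<open>F\<close> is smooth (\<open>smooth_on_extended_field\<close>); this follows
  from Cramer's rule, once smooth functions are known to be closed under sums, products and division.
\<close>

section \<open>Calculus of smooth maps\<close>

lemma C_k_on_SucD:
  assumes "C_k_on (Suc k) S f"
  shows "x \<in> S \<Longrightarrow> (f has_derivative frechet_derivative f (at x)) (at x)"
    and "C_k_on k S (\<lambda>x. frechet_derivative f (at x) v)"
  using assms by (auto simp: frechet_derivative_works)

lemma C_k_on_cong:
  assumes "open S" and "C_k_on k S f" and "\<And>x. x \<in> S \<Longrightarrow> f x = g x"
  shows "C_k_on k S g"
  using assms(2,3)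
proof (induction k arbitrary: f g)
  case 0
  then show ?case by (simp cong: continuous_on_cong)
next
  case (Suc k)
  have der: "(g has_derivative frechet_derivative f (at x)) (at x)" if "x \<in> S" for x
    using has_derivative_transform_within_open[OF C_k_on_SucD(1)[OF Suc.prems(1) that] \<open>open S\<close> that]
      Suc.prems(2) by blast
  have "C_k_on k S (\<lambda>x. frechet_derivative g (at x) v)" for v
    by (rule Suc.IH[OF C_k_on_SucD(2)[OF Suc.prems(1), of v]])
      (simp add: frechet_derivative_at[OF der])
  with der show ?case
    by (auto simp: differentiable_def)
qed

lemma C_k_on_SucI:
  assumes "open S" and "\<And>x. x \<in> S \<Longrightarrow> (f has_derivative f' x) (at x)"
    and "\<And>v. C_k_on k S (\<lambda>x. f' x v)"
  shows "C_k_on (Suc k) S f"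
proof -
  have "C_k_on k S (\<lambda>x. frechet_derivative f (at x) v)" for v
    by (rule C_k_on_cong[OF assms(1) assms(3)[of v]]) (simp add: frechet_derivative_at[OF assms(2)])
  with assms(2) show ?thesis
    by (auto simp: differentiable_def)
qed

lemma C_k_on_Suc_imp: "C_k_on (Suc k) S f \<Longrightarrow> C_k_on k S f"
proof (induction k arbitrary: f)
  case 0
  then show ?case
    by (auto intro!: continuous_at_imp_continuous_on differentiable_imp_continuous_within)
next
  case (Suc k)
  then show ?case by (metis C_k_on.simps(2))
qed

lemma C_k_on_const: "C_k_on k S (\<lambda>x. c)"
  by (induction k arbitrary: c) (auto simp: frechet_derivative_const)

lemma C_k_on_ident:
  assumes "open S"
  shows "C_k_on k S (\<lambda>x. x)"
proof (cases k)
  case (Suc m)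
  show ?thesis
    unfolding Suc by (rule C_k_on_SucI[OF assms has_derivative_ident C_k_on_const])
qed simp

lemma C_k_on_bounded_linear:
  assumes "open S" and "bounded_linear L" and "C_k_on k S f"
  shows "C_k_on k S (\<lambda>x. L (f x))"
  using assms(3)
proof (induction k arbitrary: f)
  case 0
  then show ?case
    using bounded_linear.continuous_on[OF assms(2)] by simp
next
  case (Suc k)
  show ?case
    by (rule C_k_on_SucI[OF assms(1) bounded_linear.has_derivative[OF assms(2)]])
      (use Suc C_k_on_SucD[OF Suc.prems] in auto)
qed

lemma C_k_on_add:
  assumes "open S" and "C_k_on k S f" and "C_k_on k S g"
  shows "C_k_on k S (\<lambda>x. f x + g x)"
  using assms(2,3)
proof (induction k arbitrary: f g)
  case 0
  then show ?case by (simp add: continuous_on_add)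
next
  case (Suc k)
  note f = C_k_on_SucD[OF Suc.prems(1)] and g = C_k_on_SucD[OF Suc.prems(2)]
  show ?case
    by (rule C_k_on_SucI[OF assms(1) has_derivative_add[OF f(1) g(1)] Suc.IH[OF f(2) g(2)]])
qed

text \<open>The product rule expresses the derivative of a product by products of functions which are
  differentiable one time less, so one induction covers all continuous bilinear products.\<close>

lemma C_k_on_bilinear:
  assumes "open S" and "bounded_bilinear B" and "C_k_on k S f" and "C_k_on k S g"
  shows "C_k_on k S (\<lambda>x. B (f x) (g x))"
  using assms(3,4)
proof (induction k arbitrary: f g)
  case 0
  then show ?case
    using bounded_bilinear.continuous_on[OF assms(2)] by simp
next
  case (Suc k)
  note f = C_k_on_SucD[OF Suc.prems(1)] and g = C_k_on_SucD[OF Suc.prems(2)]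
  show ?case
  proof (rule C_k_on_SucI[OF assms(1) bounded_bilinear.FDERIV[OF assms(2) f(1) g(1)]])
    fix v
    show "C_k_on k S (\<lambda>x. B (f x) (frechet_derivative g (at x) v) +
        B (frechet_derivative f (at x) v) (g x))"
      using Suc.IH f(2) g(2) Suc.prems[THEN C_k_on_Suc_imp] by (intro C_k_on_add assms(1)) auto
  qed
qed

text \<open>The derivative \<open>- g' / g\<^sup>2\<close> of \<open>1 / g\<close> again involves only \<open>1 / g\<close> itself and the
  derivative of \<open>g\<close>, so the induction can use its hypothesis for \<open>1 / g\<close>.\<close>

lemma C_k_on_inverse:
  fixes g :: "'a::real_normed_vector \<Rightarrow> real"
  assumes "open S" and "C_k_on k S g" and nz: "\<And>x. x \<in> S \<Longrightarrow> g x \<noteq> 0"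
  shows "C_k_on k S (\<lambda>x. inverse (g x))"
  using assms(2)
proof (induction k)
  case 0
  with nz show ?case by (auto intro: continuous_on_inverse)
next
  case (Suc k)
  note g = C_k_on_SucD[OF Suc.prems]
  have inv: "C_k_on k S (\<lambda>x. inverse (g x))"
    using Suc C_k_on_Suc_imp by blast
  show ?case
  proof (rule C_k_on_SucI[OF assms(1) Deriv.has_derivative_inverse[OF nz g(1)]])
    fix v
    show "C_k_on k S (\<lambda>x. - (inverse (g x) * frechet_derivative g (at x) v * inverse (g x)))"
      by (intro C_k_on_bounded_linear[where L = uminus]
          C_k_on_bilinear[where B = "(*)"] bounded_bilinear_mult bounded_linear_minus
          bounded_linear_ident assms(1) inv g(2))
  qed auto
qed

lemma smooth_on_cong:
  assumes "open S" and "smooth_on S f" and "\<And>x. x \<in> S \<Longrightarrow> f x = g x"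
  shows "smooth_on S g"
  using assms(2) C_k_on_cong[OF assms(1) _ assms(3)] unfolding smooth_on_def by simp

lemma smooth_on_const: "smooth_on S (\<lambda>x. c)"
  by (simp add: smooth_on_def C_k_on_const)

lemma smooth_on_bounded_linear:
  "open S \<Longrightarrow> bounded_linear L \<Longrightarrow> smooth_on S f \<Longrightarrow> smooth_on S (\<lambda>x. L (f x))"
  by (simp add: smooth_on_def C_k_on_bounded_linear)

lemma bounded_linear_imp_smooth_on:
  "open S \<Longrightarrow> bounded_linear L \<Longrightarrow> smooth_on S L"
  using C_k_on_bounded_linear[OF _ _ C_k_on_ident] by (auto simp: smooth_on_def)

lemma smooth_on_add:
  "open S \<Longrightarrow> smooth_on S f \<Longrightarrow> smooth_on S g \<Longrightarrow> smooth_on S (\<lambda>x. f x + g x)"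
  by (simp add: smooth_on_def C_k_on_add)

lemma smooth_on_bilinear:
  "open S \<Longrightarrow> bounded_bilinear B \<Longrightarrow> smooth_on S f \<Longrightarrow> smooth_on S g \<Longrightarrow>
    smooth_on S (\<lambda>x. B (f x) (g x))"
  by (simp add: smooth_on_def C_k_on_bilinear)

lemma smooth_on_divide:
  fixes f g :: "'a::real_normed_vector \<Rightarrow> real"
  assumes "open S" and "smooth_on S f" and "smooth_on S g" and "\<And>x. x \<in> S \<Longrightarrow> g x \<noteq> 0"
  shows "smooth_on S (\<lambda>x. f x / g x)"
  using assms unfolding smooth_on_def divide_inverse
  by (intro allI C_k_on_bilinear[where B = "(*)"] bounded_bilinear_mult C_k_on_inverse) auto

lemma smooth_on_sum:
  assumes "open S" and "\<And>i. i \<in> I \<Longrightarrow> smooth_on S (f i)"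
  shows "smooth_on S (\<lambda>x. \<Sum>i\<in>I. f i x)"
  using assms(2) by (induction I rule: infinite_finite_induct)
    (auto simp: smooth_on_const intro: smooth_on_add[OF assms(1)])

lemma smooth_on_prod:
  fixes f :: "'i \<Rightarrow> 'a::real_normed_vector \<Rightarrow> real"
  assumes "open S" and "\<And>i. i \<in> I \<Longrightarrow> smooth_on S (f i)"
  shows "smooth_on S (\<lambda>x. \<Prod>i\<in>I. f i x)"
  using assms(2) by (induction I rule: infinite_finite_induct)
    (auto simp: smooth_on_const intro: smooth_on_bilinear[OF assms(1) bounded_bilinear_mult])

lemma smooth_on_Pair:
  assumes "open S" and "smooth_on S f" and "smooth_on S g"
  shows "smooth_on S (\<lambda>x. (f x, g x))"
proof -
  have "smooth_on S (\<lambda>x. (f x, 0) + (0, g x))"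
    by (intro smooth_on_add smooth_on_bounded_linear[where L = "\<lambda>u. (u, 0)"]
        smooth_on_bounded_linear[where L = "\<lambda>u. (0, u)"] assms
        bounded_linear_Pair bounded_linear_ident bounded_linear_zero)
  then show ?thesis by simp
qed

lemma smooth_on_vec:
  fixes f :: "'a::real_normed_vector \<Rightarrow> real^'m"
  assumes "open S" and "\<And>i. smooth_on S (\<lambda>x. f x $ i)"
  shows "smooth_on S f"
proof -
  have "smooth_on S (\<lambda>x. \<Sum>i\<in>UNIV. (f x $ i) *\<^sub>R (axis i 1 :: real^'m))"
    by (intro smooth_on_sum smooth_on_bilinear[where B = scaleR]
        bounded_bilinear_scaleR smooth_on_const assms)
  moreover have "(\<Sum>i\<in>UNIV. (f x $ i) *\<^sub>R axis i 1) = f x" for x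
    using basis_expansion[of "f x"] by (simp add: scalar_mult_eq_scaleR)
  ultimately show ?thesis by simp
qed

lemma smooth_on_det:
  fixes M :: "'a::real_normed_vector \<Rightarrow> real^'m^'m"
  assumes "open S" and "\<And>i j. smooth_on S (\<lambda>z. M z $ i $ j)"
  shows "smooth_on S (\<lambda>z. det (M z))"
  unfolding det_def
  by (intro smooth_on_sum smooth_on_bilinear[where B = "(*)"] smooth_on_prod
      bounded_bilinear_mult smooth_on_const assms)

text \<open>By Cramer's rule the solution of a linear system is a rational function of its
  coefficients whose denominator is the determinant.\<close>

lemma smooth_on_linear_solve:
  fixes M :: "'a::real_normed_vector \<Rightarrow> real^'m^'m"
  assumes "open S" and M: "\<And>i j. smooth_on S (\<lambda>z. M z $ i $ j)"
    and w: "\<And>i. smooth_on S (\<lambda>z. w z $ i)"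
    and det: "\<And>z. z \<in> S \<Longrightarrow> det (M z) \<noteq> 0" and sol: "\<And>z. z \<in> S \<Longrightarrow> M z *v y z = w z"
  shows "smooth_on S y"
proof (rule smooth_on_vec[OF assms(1)])
  fix k
  let ?N = "\<lambda>z. \<chi> i j. if j = k then w z $ i else M z $ i $ j"
  have "smooth_on S (\<lambda>z. ?N z $ i $ j)" for i j
    using M w by (cases "j = k") auto
  then have "smooth_on S (\<lambda>z. det (?N z) / det (M z))"
    by (intro smooth_on_divide smooth_on_det assms(1) M det)
  then show "smooth_on S (\<lambda>z. y z $ k)"
  proof (rule smooth_on_cong[OF assms(1)])
    fix z assume "z \<in> S"
    then show "det (?N z) / det (M z) = y z $ k"
      using cramer[OF det, of z "y z" "w z"] sol by simp
  qed
qed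

section \<open>Quadratic invariants of symplectic Runge-Kutta methods\<close>

lemma quadratic_has_derivative:
  fixes L :: "'a::euclidean_space \<Rightarrow> 'a"
  assumes "linear L"
  shows "((\<lambda>z. z \<bullet> L z + c \<bullet> z + k) has_derivative (\<lambda>v. z \<bullet> L v + v \<bullet> L z + c \<bullet> v)) (at z)"
proof -
  have "bounded_linear L"
    using assms by (simp add: linear_conv_bounded_linear)
  from bounded_linear.has_derivative[OF this has_derivative_ident]
  have L: "(L has_derivative L) (at z)" .
  show ?thesis
    by (auto intro!: derivative_eq_intros L)
qed

text \<open>Write \<open>I z = q z + c \<bullet> z + k\<close> and let \<open>B\<close> be the symmetric bilinear form with
  \<open>B u u = 2 q u\<close>. With stage slopes \<open>K i = g (Z i)\<close> and \<open>w = \<Sum>i. b i K i\<close> one has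
  \<open>I (z0 + h w) - I z0 = h (B z0 w + c \<bullet> w) + h\<^sup>2 q w\<close>. Invariance says
  \<open>B (Z i) (K i) + c \<bullet> K i = 0\<close> at the stages; moving from \<open>Z i\<close> back to \<open>z0\<close> turns the first
  term into \<open>- h\<^sup>2 (\<Sum>i j. b i a i j B (K j) (K i))\<close>. Symmetrised in \<open>i\<close> and \<open>j\<close>, this sum is
  half of \<open>\<Sum>i j. b i b j B (K j) (K i) = 2 q w\<close> by symplecticity, so the two terms cancel.\<close>

theorem symplectic_rk_preserves_quadratic:
  fixes g :: "'a::euclidean_space \<Rightarrow> 'a"
  assumes sympl: "symplectic_rk a b" and "quadratic I" and inv: "invariant_on V g I"
    and step: "rk_step a b g V h z0 z1"
  shows "I z1 = I z0"
proof -
  obtain L c k where L: "linear L" and I: "I = (\<lambda>z. z \<bullet> L z + c \<bullet> z + k)"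
    using \<open>quadratic I\<close> unfolding quadratic_def by fast
  obtain Z where ZV: "\<And>i. Z i \<in> V"
    and Z: "\<And>i. Z i = z0 + h *\<^sub>R (\<Sum>j\<in>UNIV. a i j *\<^sub>R g (Z j))"
    and z1: "z1 = z0 + h *\<^sub>R (\<Sum>i\<in>UNIV. b i *\<^sub>R g (Z i))"
    using step unfolding rk_step_def by blast
  define K where "K i = g (Z i)" for i
  define B where "B u v = u \<bullet> L v + v \<bullet> L u" for u v
  have B_sym: "B u v = B v u" for u v
    by (simp add: B_def)
  have B_add: "B (u + v) w = B u w + B v w" for u v w
    by (simp add: B_def linear_add[OF L] inner_simps)
  have B_scale: "B (r *\<^sub>R u) w = r * B u w" for r u w
    by (simp add: B_def linear_scale[OF L] algebra_simps)
  have B_sum: "B (\<Sum>j\<in>UNIV. s j *\<^sub>R K j) w = (\<Sum>j\<in>UNIV. s j * B (K j) w)" for s w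
  proof -
    have "linear (\<lambda>u. B u w)"
      by (rule linearI) (simp_all add: B_add B_scale)
    then show ?thesis
      using linear_sum[of "\<lambda>u. B u w" "\<lambda>j. s j *\<^sub>R K j" UNIV] by (simp add: B_scale)
  qed
  have grad: "B (Z i) (K i) + c \<bullet> K i = 0" for i
  proof -
    obtain d where d: "GDERIV I (Z i) :> d" and "d \<bullet> K i = 0"
      using bspec[OF inv[unfolded invariant_on_def] ZV[of i]] unfolding K_def by (elim exE conjE)
    have "(\<lambda>v. v \<bullet> d) = (\<lambda>v. Z i \<bullet> L v + v \<bullet> L (Z i) + c \<bullet> v)"
      using has_derivative_unique[OF d[unfolded gderiv_def I] quadratic_has_derivative[OF L]] .
    from fun_cong[OF this, of "K i"] \<open>d \<bullet> K i = 0\<close> show ?thesis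
      by (simp add: B_def inner_commute)
  qed
  have start: "B z0 (K i) + c \<bullet> K i = - h * (\<Sum>j\<in>UNIV. a i j * B (K j) (K i))" for i
  proof -
    have "B (Z i) (K i) = B z0 (K i) + h * (\<Sum>j\<in>UNIV. a i j * B (K j) (K i))"
      by (subst Z) (simp add: B_add B_scale B_sum flip: K_def)
    with grad[of i] show ?thesis by simp
  qed
  define w where "w = (\<Sum>i\<in>UNIV. b i *\<^sub>R K i)"
  have z1w: "z1 = z0 + h *\<^sub>R w"
    by (simp add: z1 w_def K_def)
  have Bw: "B z0 w + c \<bullet> w = (\<Sum>i\<in>UNIV. b i * (B z0 (K i) + c \<bullet> K i))"
    unfolding w_def
    by (subst B_sym) (simp add: B_sum B_sym[of "K _" z0] inner_sum_right sum.distrib distrib_left)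
  have Bww: "B w w = (\<Sum>i\<in>UNIV. \<Sum>j\<in>UNIV. b i * b j * B (K j) (K i))"
  proof -
    have "B w w = (\<Sum>i\<in>UNIV. b i * B (K i) w)"
      by (subst (1) w_def) (rule B_sum)
    also have "\<dots> = (\<Sum>i\<in>UNIV. b i * (\<Sum>j\<in>UNIV. b j * B (K j) (K i)))"
      by (subst B_sym, subst w_def, subst B_sum) simp
    finally show ?thesis
      by (simp add: sum_distrib_left mult.assoc)
  qed
  \<comment> \<open>Adding \<open>X\<close> to itself with the indices exchanged produces the left side of the symplecticity condition.\<close>
  define X where "X = (\<Sum>i\<in>UNIV. \<Sum>j\<in>UNIV. b i * a i j * B (K j) (K i))"
  have "X = (\<Sum>i\<in>UNIV. \<Sum>j\<in>UNIV. b j * a j i * B (K j) (K i))"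
    unfolding X_def by (subst sum.swap) (simp add: B_sym)
  then have "2 * X = (\<Sum>i\<in>UNIV. \<Sum>j\<in>UNIV. (b i * a i j + b j * a j i) * B (K j) (K i))"
    by (simp add: X_def sum.distrib distrib_right)
  also have "\<dots> = B w w"
    using sympl by (simp add: Bww symplectic_rk_def)
  finally have X: "2 * X = B w w" .
  have "B z0 w + c \<bullet> w = - h * X"
    unfolding Bw start X_def by (simp add: sum_distrib_left sum_negf mult_ac)
  moreover have "I z1 - I z0 = h * (B z0 w + c \<bullet> w) + h^2 * (w \<bullet> L w)"
    by (simp add: I z1w B_def linear_add[OF L] linear_scale[OF L] inner_simps
        algebra_simps power2_eq_square)
  moreover have "w \<bullet> L w = X"
    using X by (simp add: B_def)
  ultimately show ?thesis
    by (simp add: power2_eq_square)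
qed

section \<open>The constraint and its Jacobian\<close>

text \<open>The components of the constraint are halves of the quadratic forms of these self-adjoint
  operators, which are the symmetric block matrices \<open>Q\<^sup>i\<close> acting on pairs.\<close>

definition constraint_form ::
  "('d::finite \<Rightarrow> real^'n^'n) \<Rightarrow> ('d \<Rightarrow> real^'d^'n) \<Rightarrow> ('d \<Rightarrow> real^'d^'d) \<Rightarrow> 'd \<Rightarrow>
    (real^'n) \<times> (real^'d) \<Rightarrow> (real^'n) \<times> (real^'d)"
where
  "constraint_form Q11 Q12 Q22 i z =
    (Q11 i *v fst z + Q12 i *v snd z, transpose (Q12 i) *v fst z + Q22 i *v snd z)"

lemma linear_constraint_form: "linear (constraint_form Q11 Q12 Q22 i)"
  by (rule linearI) (simp_all add: constraint_form_def matrix_vector_right_distrib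
      matrix_vector_mult_scaleR algebra_simps)

lemma constraint_map_nth:
  "constraint_map Q11 Q12 Q22 z $ i = z \<bullet> (1/2) *\<^sub>R constraint_form Q11 Q12 Q22 i z + 0 \<bullet> z + 0"
  by (cases z) (simp add: constraint_map_def constraint_form_def)

lemma quadratic_constraint_map: "quadratic (\<lambda>z. constraint_map Q11 Q12 Q22 z $ i)"
  unfolding constraint_map_nth quadratic_def
  by (intro exI[of _ "\<lambda>z. (1/2) *\<^sub>R constraint_form Q11 Q12 Q22 i z"] exI[of _ 0] conjI
      linear_compose_scale_right linear_constraint_form) auto

lemma inner_matrix_transpose:
  fixes M :: "real^'m^'k"
  shows "x \<bullet> (M *v y) = (transpose M *v x) \<bullet> y"
  by (simp add: dot_lmul_matrix)

lemma constraint_form_self_adjoint: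
  assumes "\<And>i. transpose (Q11 i) = Q11 i" and "\<And>i. transpose (Q22 i) = Q22 i"
  shows "z \<bullet> constraint_form Q11 Q12 Q22 i w = constraint_form Q11 Q12 Q22 i z \<bullet> w"
  by (simp add: constraint_form_def inner_prod_def inner_add_left inner_add_right assms
      inner_matrix_transpose del: transpose_matrix_vector)

text \<open>The gradient of \<open>z \<bullet> S z / 2\<close> for a self-adjoint \<open>S\<close> is \<open>S z\<close>. Thus the \<open>i\<close>-th row of
  \<open>(A | B)\<close> is the operator of the \<open>i\<close>-th constraint applied to \<open>z\<close>.\<close>

lemma constraint_jacobian_nth:
  assumes "\<And>i. transpose (Q11 i) = Q11 i" and "\<And>i. transpose (Q22 i) = Q22 i"
  shows "(jac_A Q11 Q12 z *v fst w + jac_B Q12 Q22 z *v snd w) $ i =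
    constraint_form Q11 Q12 Q22 i z \<bullet> w"
  using assms by (cases z, cases w) (simp add: jac_A_def jac_B_def constraint_form_def
      matrix_vector_mul_component flip: transpose_matrix_vector)

lemma constraint_map_has_derivative:
  assumes "\<And>i. transpose (Q11 i) = Q11 i" and "\<And>i. transpose (Q22 i) = Q22 i"
  shows "((constraint_map Q11 Q12 Q22 :: _ \<Rightarrow> real^'d::finite) has_derivative
    (\<lambda>w. jac_A Q11 Q12 z *v fst w + jac_B Q12 Q22 z *v snd w)) (at z)"
proof -
  let ?S = "constraint_form Q11 Q12 Q22"
  have "((\<lambda>z. constraint_map Q11 Q12 Q22 z $ i) has_derivative
      (\<lambda>w. (jac_A Q11 Q12 z *v fst w + jac_B Q12 Q22 z *v snd w) $ i)) (at z)" for i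
  proof -
    have "linear (\<lambda>z. (1/2) *\<^sub>R ?S i z)"
      by (intro linear_compose_scale_right linear_constraint_form)
    then show ?thesis
      unfolding constraint_map_nth constraint_jacobian_nth[OF assms]
      by (rule has_derivative_eq_rhs[OF quadratic_has_derivative])
        (simp add: constraint_form_self_adjoint[OF assms, of z] inner_commute[of _ "?S i z"])
  qed
  note component = this
  show ?thesis
  proof (rule has_derivative_componentwise_within[THEN iffD2], rule ballI)
    fix v :: "real^'d" assume "v \<in> Basis"
    then obtain i where v: "v = axis i 1"
      by (auto simp: Basis_vec_def)
    show "((\<lambda>z. constraint_map Q11 Q12 Q22 z \<bullet> v) has_derivative
        (\<lambda>w. (jac_A Q11 Q12 z *v fst w + jac_B Q12 Q22 z *v snd w) \<bullet> v)) (at z)"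
      using component[of i] by (simp only: v inner_axis inner_real_def mult_1_right)
  qed
qed

lemma smooth_on_jac_A_times:
  assumes "open S" and "smooth_on S u"
  shows "smooth_on S (\<lambda>z. (jac_A Q11 Q12 z *v u z) $ i)"
proof -
  have "linear (\<lambda>z. jac_A Q11 Q12 z $ i)"
    by (rule linearI) (auto simp: jac_A_def case_prod_beta matrix_vector_right_distrib
      matrix_vector_mult_scaleR algebra_simps vector_matrix_left_distrib scaleR_vector_matrix_assoc)
  then show ?thesis
    unfolding matrix_vector_mul_component linear_conv_bounded_linear
    by (intro smooth_on_bilinear[where B = inner] bounded_bilinear_inner
        bounded_linear_imp_smooth_on assms)
qed

lemma smooth_on_jac_B:
  assumes "open S"
  shows "smooth_on S (\<lambda>z. jac_B Q12 Q22 z $ i $ j)"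
proof -
  have "linear (\<lambda>z. jac_B Q12 Q22 z $ i $ j)"
    by (rule linearI) (auto simp: jac_B_def case_prod_beta matrix_vector_right_distrib
      matrix_vector_mult_scaleR algebra_simps vector_matrix_left_distrib scaleR_vector_matrix_assoc)
  then show ?thesis
    unfolding linear_conv_bounded_linear by (rule bounded_linear_imp_smooth_on[OF assms])
qed

section \<open>The extended field\<close>

lemma full_rank_imp_invertible:
  fixes M :: "real^'m^'m"
  assumes "rank M = CARD('m)"
  shows "invertible M"
  using assms by (simp add: full_rank_injective invertible_left_inverse matrix_left_invertible_injective)

text \<open>By its definition the pseudoinverse is a left inverse, and for square matrices a left inverse
  is also a right inverse.\<close>

lemma pseudo_inv_right_inverse:
  fixes M :: "real^'m^'m"
  assumes "invertible M"
  shows "M ** pseudo_inv M = mat 1"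
proof -
  have "invertible (transpose M ** M)"
    using assms by (simp add: invertible_mult invertible_det_nz det_mul det_transpose)
  then have "matrix_inv (transpose M ** M) ** (transpose M ** M) = mat 1"
    unfolding matrix_inv_def invertible_def by (rule someI2_ex) simp
  then have "pseudo_inv M ** M = mat 1"
    by (simp add: pseudo_inv_def matrix_mul_assoc)
  then show ?thesis
    by (simp add: matrix_left_right_inverse)
qed

text \<open>The second component of the field solves \<open>B v = - A f'\<close>, which is the linearised constraint
  for the velocity \<open>(f', v)\<close>. As \<open>B\<close> is injective, this equation also characterises that
  component, which is how smoothness and the lifting of solutions are obtained from it.\<close>

lemma extended_field_tangent:
  fixes Q11 :: "'d::finite \<Rightarrow> real^'n^'n"
  assumes "rank (jac_B Q12 Q22 z) = CARD('d)"
  shows "jac_A Q11 Q12 z *v fst (extended_field Q11 Q12 Q22 f' z) +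
    jac_B Q12 Q22 z *v snd (extended_field Q11 Q12 Q22 f' z) = 0"
proof -
  have "jac_B Q12 Q22 z *v (pseudo_inv (jac_B Q12 Q22 z) *v v) = v" for v
    using pseudo_inv_right_inverse[OF full_rank_imp_invertible[OF assms]]
    by (simp add: matrix_vector_mul_assoc)
  then show ?thesis
    by (simp add: extended_field_def linear_neg)
qed

lemma extended_field_preserves_constraint:
  fixes Q11 :: "'d::finite \<Rightarrow> real^'n^'n"
  assumes sym: "\<And>i. transpose (Q11 i) = Q11 i" "\<And>i. transpose (Q22 i) = Q22 i"
    and rank: "\<And>z. z \<in> D \<Longrightarrow> rank (jac_B Q12 Q22 z) = CARD('d)"
  shows "invariant_on D (extended_field Q11 Q12 Q22 f') (\<lambda>z. constraint_map Q11 Q12 Q22 z $ i)"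
  unfolding invariant_on_def
proof (intro ballI exI conjI)
  fix z assume "z \<in> D"
  show "GDERIV (\<lambda>z. constraint_map Q11 Q12 Q22 z $ i) z :> constraint_form Q11 Q12 Q22 i z"
    using bounded_linear.has_derivative[OF bounded_linear_vec_nth constraint_map_has_derivative[OF sym]]
    unfolding gderiv_def constraint_jacobian_nth[OF sym] by (simp add: inner_commute)
  show "constraint_form Q11 Q12 Q22 i z \<bullet> extended_field Q11 Q12 Q22 f' z = 0"
    using extended_field_tangent[OF rank[OF \<open>z \<in> D\<close>], of Q11 f']
    by (simp flip: constraint_jacobian_nth[OF sym])
qed

text \<open>The pseudoinverse is defined through \<open>matrix_inv\<close>, a choice of an inverse, and cannot be
  differentiated directly. Cramer's rule applies to the equation \<open>B v = - A f'\<close> instead.\<close>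

lemma smooth_on_extended_field:
  fixes Q11 :: "'d::finite \<Rightarrow> real^'n^'n"
  assumes "open D" and f': "smooth_on D f'"
    and rank: "\<And>z. z \<in> D \<Longrightarrow> rank (jac_B Q12 Q22 z) = CARD('d)"
  shows "smooth_on D (extended_field Q11 Q12 Q22 f')"
proof -
  let ?F = "extended_field Q11 Q12 Q22 f'"
  have "smooth_on D (\<lambda>z. snd (?F z))"
  proof (rule smooth_on_linear_solve[where M = "jac_B Q12 Q22" and
        w = "\<lambda>z. - (jac_A Q11 Q12 z *v f' z)", OF \<open>open D\<close> smooth_on_jac_B[OF \<open>open D\<close>]])
    show "smooth_on D (\<lambda>z. (- (jac_A Q11 Q12 z *v f' z)) $ i)" for i
      unfolding vector_uminus_component
      by (intro smooth_on_bounded_linear[where L = uminus] bounded_linear_minus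
          bounded_linear_ident smooth_on_jac_A_times \<open>open D\<close> f')
    fix z assume "z \<in> D"
    show "det (jac_B Q12 Q22 z) \<noteq> 0"
      using full_rank_imp_invertible[OF rank[OF \<open>z \<in> D\<close>]] by (simp add: invertible_det_nz)
    have "fst (?F z) = f' z"
      by (simp add: extended_field_def)
    with extended_field_tangent[OF rank[OF \<open>z \<in> D\<close>], of Q11 f']
    show "jac_B Q12 Q22 z *v snd (?F z) = - (jac_A Q11 Q12 z *v f' z)"
      by (simp add: eq_neg_iff_add_eq_0 add.commute)
  qed
  with f' have "smooth_on D (\<lambda>z. (f' z, snd (?F z)))"
    by (intro smooth_on_Pair \<open>open D\<close>)
  then show ?thesis
    by (rule smooth_on_cong[OF \<open>open D\<close>]) (simp add: extended_field_def)
qed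

text \<open>Differentiating \<open>G (x, \<phi> x) = 0\<close> in the direction \<open>f x\<close> shows that the derivative of
  \<open>\<phi>\<close> in this direction satisfies the same linear equation as the second component of the
  extended field.\<close>

lemma graph_lift_solves_extended:
  fixes Q11 :: "'d::finite \<Rightarrow> real^'n^'n"
  assumes sym: "\<And>i. transpose (Q11 i) = Q11 i" "\<And>i. transpose (Q22 i) = Q22 i"
    and rank: "\<And>z. z \<in> D \<Longrightarrow> rank (jac_B Q12 Q22 z) = CARD('d)"
    and "open U" and \<phi>: "\<And>x. x \<in> U \<Longrightarrow> \<phi> differentiable (at x)"
    and graph: "\<And>x. x \<in> U \<Longrightarrow> (x, \<phi> x) \<in> constraint_manifold Q11 Q12 Q22 D"
    and f': "\<And>x. x \<in> U \<Longrightarrow> f' (x, \<phi> x) = f x"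
    and sol: "solves_ode_on J f U X"
  shows "solves_ode_on J (extended_field Q11 Q12 Q22 f') D (\<lambda>t. (X t, \<phi> (X t)))"
  unfolding solves_ode_on_def
proof (intro ballI conjI)
  fix t assume "t \<in> J"
  define x where "x = X t"
  have x: "x \<in> U" and X: "(X has_vector_derivative f x) (at t)"
    using sol \<open>t \<in> J\<close> by (auto simp: solves_ode_on_def x_def)
  have D: "(x, \<phi> x) \<in> D"
    using graph[OF x] by (simp add: constraint_manifold_def)
  then show "(X t, \<phi> (X t)) \<in> D"
    by (simp add: x_def)
  let ?A = "jac_A Q11 Q12 (x, \<phi> x)" and ?B = "jac_B Q12 Q22 (x, \<phi> x)"
  let ?F = "extended_field Q11 Q12 Q22 f' (x, \<phi> x)"
  obtain \<phi>' where \<phi>': "(\<phi> has_derivative \<phi>') (at x)"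
    using \<phi>[OF x] by (auto simp: differentiable_def)
  have "((\<lambda>x. constraint_map Q11 Q12 Q22 (x, \<phi> x)) has_derivative
      (\<lambda>v. ?A *v v + ?B *v \<phi>' v)) (at x)"
    using has_derivative_compose[OF has_derivative_Pair[OF has_derivative_ident \<phi>']
        constraint_map_has_derivative[OF sym]] by simp
  moreover have "((\<lambda>x. constraint_map Q11 Q12 Q22 (x, \<phi> x)) has_derivative (\<lambda>v. 0)) (at x)"
    using graph by (intro has_derivative_transform_within_open[OF has_derivative_const \<open>open U\<close> x, of 0])
      (auto simp: constraint_manifold_def)
  ultimately have "(\<lambda>v. ?A *v v + ?B *v \<phi>' v) = (\<lambda>v. 0)"
    by (rule has_derivative_unique)
  then have "?A *v f x + ?B *v \<phi>' (f x) = 0"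
    by (rule fun_cong)
  moreover have fst: "fst ?F = f x"
    by (simp add: extended_field_def f'[OF x])
  ultimately have "?B *v \<phi>' (f x) = ?B *v snd ?F"
    using extended_field_tangent[OF rank[OF D], of Q11 f'] by (metis add_left_cancel)
  then have "\<phi>' (f x) = snd ?F"
    using rank[OF D] by (simp add: full_rank_injective inj_eq)
  with fst have F: "?F = (f x, \<phi>' (f x))"
    by (simp add: prod_eq_iff)
  have "((\<lambda>t. \<phi> (X t)) has_vector_derivative \<phi>' (f x)) (at t)"
    using has_derivative_compose[OF X[unfolded has_vector_derivative_def] \<phi>'[unfolded x_def]]
      linear_scale[OF has_derivative_linear[OF \<phi>']] by (simp add: has_vector_derivative_def)
  with X show "((\<lambda>t. (X t, \<phi> (X t))) has_vector_derivative
      extended_field Q11 Q12 Q22 f' (X t, \<phi> (X t))) (at t)"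
    using F by (simp add: x_def has_vector_derivative_Pair)
qed

theorem proposition2:
  fixes a :: "'s::finite \<Rightarrow> 's \<Rightarrow> real" and b :: "'s \<Rightarrow> real"
    and U :: "(real^'n) set" and D :: "((real^'n) \<times> (real^'d)) set"
    and f :: "real^'n \<Rightarrow> real^'n" and H :: "real^'n \<Rightarrow> real"
    and Q11 :: "'d \<Rightarrow> real^'n^'n" and Q12 :: "'d \<Rightarrow> real^'d^'n" and Q22 :: "'d \<Rightarrow> real^'d^'d"
    and \<phi> :: "real^'n \<Rightarrow> real^'d"
    and H' :: "(real^'n) \<times> (real^'d) \<Rightarrow> real"
    and f' :: "(real^'n) \<times> (real^'d) \<Rightarrow> real^'n"
  defines "G \<equiv> constraint_map Q11 Q12 Q22"
    and "M \<equiv> constraint_manifold Q11 Q12 Q22 D"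
    and "F \<equiv> extended_field Q11 Q12 Q22 f'"
  assumes "symplectic_rk a b"
    and "open U" and "open D"
    and "smooth_on U f" and "smooth_on U H" and "invariant_on U f H"
    and "\<And>i. transpose (Q11 i) = Q11 i" and "\<And>i. transpose (Q22 i) = Q22 i"
    and "\<And>z. z \<in> D \<Longrightarrow> rank (jac_B Q12 Q22 z) = CARD('d)"
    and "smooth_on U \<phi>" and "M = (\<lambda>x. (x, \<phi> x)) ` U"
    and "quadratic H'" and "\<And>x y. (x, y) \<in> M \<Longrightarrow> H' (x, y) = H x"
    and "smooth_on D f'" and "\<And>x. x \<in> U \<Longrightarrow> f' (x, \<phi> x) = f x"
  shows
    "(\<forall>I h z0 z1. quadratic I \<and> invariant_on D F I \<and> rk_step a b F D h z0 z1 \<longrightarrow> I z1 = I z0) \<and>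
     (\<forall>h z N. z 0 \<in> D \<and> G (z 0) = 0 \<and> (\<forall>k<N. rk_step a b F D h (z k) (z (Suc k))) \<longrightarrow>
        (\<forall>k\<le>N. z k \<in> M \<and> G (z k) = 0)) \<and>
     (\<forall>h x0 x1. x0 \<in> U \<and> reduced_step a b F \<phi> D h x0 x1 \<longrightarrow>
        x1 \<in> U \<and> (invariant_on D F H' \<longrightarrow> H x1 = H x0)) \<and>
     (\<forall>p. rk_has_order TYPE((real^'n) \<times> (real^'d)) p a b \<longrightarrow>
        has_order p f U (\<lambda>r h x0. reduced_step a b F \<phi> (D \<inter> ball (x0, \<phi> x0) r) h x0))"
proof (intro conjI allI impI; (elim conjE)?)
  note sympl = assms(4)
  note sym = assms(10,11) and rank = assms(12)
  have F_step: "I z1 = I z0"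
    if "quadratic I" "invariant_on D F I" "rk_step a b F D h z0 z1" for I h z0 z1
    using symplectic_rk_preserves_quadratic[OF sympl that] .
  have G_step: "G z1 = G z0" if "rk_step a b F D h z0 z1" for h z0 z1
  proof -
    have "quadratic (\<lambda>z. G z $ i)" for i
      unfolding G_def by (rule quadratic_constraint_map)
    moreover have "invariant_on D F (\<lambda>z. G z $ i)" for i
      unfolding F_def G_def by (rule extended_field_preserves_constraint[OF sym rank])
    ultimately have "G z1 $ i = G z0 $ i" for i
      by (rule F_step[OF _ _ that])
    then show ?thesis
      by (simp add: vec_eq_iff)
  qed
  have M_iff: "z \<in> M \<longleftrightarrow> z \<in> D \<and> G z = 0" for z
    by (simp add: M_def G_def constraint_manifold_def)
  have graph: "(x, \<phi> x) \<in> M" if "x \<in> U" for x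
    using that \<open>M = _\<close> by blast
  show "I z1 = I z0"
    if "quadratic I" "invariant_on D F I" "rk_step a b F D h z0 z1" for I h z0 z1
    using F_step that .
  show "z k \<in> M" "G (z k) = 0"
    if "z 0 \<in> D" "G (z 0) = 0" "\<forall>k<N. rk_step a b F D h (z k) (z (Suc k))" "k \<le> N" for h z N k
  proof -
    have "z k \<in> D \<and> G (z k) = 0"
      using that(4)
    proof (induction k)
      case (Suc k)
      with that(3) have "rk_step a b F D h (z k) (z (Suc k))" by simp
      with G_step[OF this] Suc show ?case by (simp add: rk_step_def)
    qed (use that in simp)
    then show "z k \<in> M" "G (z k) = 0"
      by (simp_all add: M_iff)
  qed
  \<comment> \<open>The constraint forces \<open>y1 = \<phi> x1\<close>: the endpoint lies on the graph.\<close>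
  {
    fix h x0 x1 assume x0: "x0 \<in> U" and "reduced_step a b F \<phi> D h x0 x1"
    then obtain y1 where step: "rk_step a b F D h (x0, \<phi> x0) (x1, y1)"
      by (auto simp: reduced_step_def)
    have "(x1, y1) \<in> D"
      using step by (simp add: rk_step_def)
    then have z1: "(x1, y1) \<in> M"
      using G_step[OF step] graph[OF x0] by (simp add: M_iff)
    then show "x1 \<in> U"
      using \<open>M = _\<close> by blast
    show "H x1 = H x0" if "invariant_on D F H'"
      using F_step[OF \<open>quadratic H'\<close> that step] assms(16)[OF z1] assms(16)[OF graph[OF x0]] by simp
  }
  fix p assume "rk_has_order TYPE((real^'n) \<times> (real^'d)) p a b"
  moreover have "smooth_on D F"
    unfolding F_def by (rule smooth_on_extended_field[OF \<open>open D\<close> \<open>smooth_on D f'\<close> rank])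
  ultimately have order: "has_order p F D (\<lambda>r h z0. rk_step a b F (D \<inter> ball z0 r) h z0)"
    using \<open>open D\<close> by (simp add: rk_has_order_def)
  have \<phi>: "\<phi> differentiable (at x)" if "x \<in> U" for x
    using \<open>smooth_on U \<phi>\<close> that C_k_on.simps(2)[of 0 U \<phi>] unfolding smooth_on_def by blast
  show "has_order p f U (\<lambda>r h x0. reduced_step a b F \<phi> (D \<inter> ball (x0, \<phi> x0) r) h x0)"
    unfolding has_order_def
  proof
    fix x0 assume x0: "x0 \<in> U"
    define z0 where "z0 = (x0, \<phi> x0)"
    have "z0 \<in> D"
      using graph[OF x0] by (simp add: M_iff z0_def)
    from bspec[OF order[unfolded has_order_def] this] obtain r where "r > 0"
      and ex1: "\<forall>\<^sub>F h in at 0. \<exists>!z1. rk_step a b F (D \<inter> ball z0 r) h z0 z1"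
      and err: "\<forall>T>0. \<forall>Z. Z 0 = z0 \<and> solves_ode_on {-T<..<T} F D Z \<longrightarrow>
        (\<exists>C. \<forall>\<^sub>F h in at 0. \<forall>z1. rk_step a b F (D \<inter> ball z0 r) h z0 z1 \<longrightarrow>
          norm (z1 - Z h) \<le> C * \<bar>h\<bar> ^ (p + 1))"
      by (elim exE conjE)
    \<comment> \<open>The radius of the extended system serves unchanged, since both steps use the same stages in \<open>D \<inter> ball z0 r\<close>.\<close>
    show "\<exists>r>0. (\<forall>\<^sub>F h in at 0. \<exists>!x1. reduced_step a b F \<phi> (D \<inter> ball (x0, \<phi> x0) r) h x0 x1) \<and>
        (\<forall>T>0. \<forall>X. X 0 = x0 \<and> solves_ode_on {-T<..<T} f U X \<longrightarrow>
          (\<exists>C. \<forall>\<^sub>F h in at 0. \<forall>x1. reduced_step a b F \<phi> (D \<inter> ball (x0, \<phi> x0) r) h x0 x1 \<longrightarrow>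
            norm (x1 - X h) \<le> C * \<bar>h\<bar> ^ (p + 1)))"
    proof (rule exI[of _ r], intro conjI allI impI \<open>r > 0\<close>; (elim conjE)?)
      show "\<forall>\<^sub>F h in at 0. \<exists>!x1. reduced_step a b F \<phi> (D \<inter> ball (x0, \<phi> x0) r) h x0 x1"
        using ex1 unfolding reduced_step_def z0_def[symmetric]
      proof eventually_elim
        case (elim h)
        then show ?case by (metis prod.collapse Pair_inject)
      qed
    next
      fix T :: real and X :: "real \<Rightarrow> real^'n"
      assume "T > 0" and X0: "X 0 = x0" and "solves_ode_on {-T<..<T} f U X"
      define Z where "Z t = (X t, \<phi> (X t))" for t
      have "solves_ode_on {-T<..<T} F D Z"
        unfolding F_def Z_def using graph \<open>open U\<close> \<phi> assms(18) \<open>solves_ode_on {-T<..<T} f U X\<close>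
        by (intro graph_lift_solves_extended[OF sym rank, where U = U]) (auto simp: M_def)
      moreover have "Z 0 = z0"
        by (simp add: Z_def X0 z0_def)
      ultimately obtain C where
        C: "\<forall>\<^sub>F h in at 0. \<forall>z1. rk_step a b F (D \<inter> ball z0 r) h z0 z1 \<longrightarrow>
          norm (z1 - Z h) \<le> C * \<bar>h\<bar> ^ (p + 1)"
        using err \<open>T > 0\<close> by blast
      have "\<forall>\<^sub>F h in at 0. \<forall>x1. reduced_step a b F \<phi> (D \<inter> ball (x0, \<phi> x0) r) h x0 x1 \<longrightarrow>
          norm (x1 - X h) \<le> C * \<bar>h\<bar> ^ (p + 1)"
        using C unfolding reduced_step_def z0_def[symmetric]
      proof (eventually_elim, safe)
        fix h x1 y1
        assume "\<forall>z1. rk_step a b F (D \<inter> ball z0 r) h z0 z1 \<longrightarrow>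
            norm (z1 - Z h) \<le> C * \<bar>h\<bar> ^ (p + 1)"
          and "rk_step a b F (D \<inter> ball z0 r) h z0 (x1, y1)"
        then have "norm ((x1, y1) - Z h) \<le> C * \<bar>h\<bar> ^ (p + 1)"
          by blast
        then show "norm (x1 - X h) \<le> C * \<bar>h\<bar> ^ (p + 1)"
          using norm_fst_le[of "x1 - X h" "y1 - \<phi> (X h)"] by (simp add: Z_def)
      qed
      then show "\<exists>C. \<forall>\<^sub>F h in at 0.
          \<forall>x1. reduced_step a b F \<phi> (D \<inter> ball (x0, \<phi> x0) r) h x0 x1 \<longrightarrow>
            norm (x1 - X h) \<le> C * \<bar>h\<bar> ^ (p + 1)" ..
    qed
  qed
qed

end
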